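(* Let $G$ and $G'$ be graphs and let $\mathbf{T}'\in\mathit{Ter}(\mathcal{B}(t))$ be a $t$-concrete tree decomposition with $\mathcal{G}(\mathbf{T}')=G'$. Then $G$ is a subgraph of $G'$ if and only if there exists $\mathbf{T}\in\mathit{Ter}(\mathcal{B}(t))$ such that $\mathbf{T}$ is a sub-decomposition of $\mathbf{T}'$ and $\mathcal{G}(\mathbf{T})=G$.
   Context: Graphs: a graph is a triple $G=(V_G,E_G,\mathrm{Inc}_G)$ with finite vertex set, finite edge set and incidence relation $\mathrm{Inc}_G\subseteq E_G\times V_G$; each edge has $0$ or $2$ endpoints (multiple edges allowed, no loops). $H$ is a subgraph of $G$ if $V_H\subseteq V_G$, $E_H\subseteq E_G$ and $\mathrm{Inc}_H=\mathrm{Inc}_G\cap(E_H\times V_H)$. Terms: for a finite alphabet $\Sigma$, $\mathit{Ter}(\Sigma)$ is the smallest set with $a$, $a(t_1)$, $a(t_1,t_2)\in\mathit{Ter}(\Sigma)$ for $a\in\Sigma$, $t_i\in\mathit{Ter}(\Sigma)$. Positions: $\mathit{Pos}(a(t_1,\dots,t_r))=\{\lambda\}\cup\bigcup_{j\le r}\{jp\mid p\in\mathit{Pos}(t_j)\}$; $pj$ is a child of $p$; $t[p]$ is the symbol at $p$. A set of positions is connected if it induces a connected subtree of the tree on $\mathit{Pos}(t)$ with arcs $\{p,pj\}$. A $t$-concrete bag is a pair $(B,b)$ with $B\subseteq\{1,\dots,t\}$, $b\subseteq B$, $b=\emptyset$ or $|b|=2$; $\mathcal{B}(t)$ is the set of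 them. A $t$-concrete tree decomposition is a term $\mathbf{T}\in\mathit{Ter}(\mathcal{B}(t))$, with $\mathbf{T}[p]=(\mathbf{T}[p].B,\mathbf{T}[p].b)$. For $s\in[t]$, a nonempty $P\subseteq\mathit{Pos}(\mathbf{T})$ is $s$-maximal if it is connected, $s\in\mathbf{T}[p].B$ for all $p\in P$, and every connected $P'$ with $s\in\mathbf{T}[p].B$ for all $p\in P'$ satisfies $P\cap P'=\emptyset$ or $P'\subseteq P$; $P(p,s)$ is the unique $s$-maximal set containing $p$ (when $s\in\mathbf{T}[p].B$). The graph $\mathcal{G}(\mathbf{T})$ has vertex set $\{v_{s,P}\mid s\in[t], P\text{ $s$-maximal}\}$, edge set $\{e_p\mid p\in\mathit{Pos}(\mathbf{T}), \mathbf{T}[p].b\ne\emptyset\}$, and incidence relation $\{(e_p,v_{s,P(p,s)})\mid e_p \text{ an edge}, s\in\mathbf{T}[p].b\}$. A $t$-concrete bag $(B,b)$ is a sub-bag of $(B',b')$ if $B\subseteq B'$ and $b\subseteq b'$. $\mathbf{T}$ is a sub-decomposition of $\mathbf{T}'$ if (S1) $\mathit{Pos}(\mathbf{T})=\mathit{Pos}(\mathbf{T}')$; (S2) for each $p$, $\mathbf{T}[p]$ is a sub-bag of $\mathbf{T}'[p]$; (S3) for all positions $p,pj$ and each $s\in[t]$, if $s\in\mathbf{T}'[p].B$ and $s\in\mathbf{T}'[pj].B$ then $s\notin\mathbf{T}[p].B$ iff $s\notin\mathbf{T}[pj].B$.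
   Formalization: The left side of the equivalence also requires that every edge of G has an endpoint; without this the claim fails, since a subgraph may keep an edge while dropping both its endpoints, whereas every edge of G(T) has two endpoints. *)

theory Defs
  imports Main
begin

record ('v, 'e) inc_graph =
  verts :: "'v set"
  edges :: "'e set"
  inc :: "('e \<times> 'v) set"

definition endpts :: "('v, 'e) inc_graph \<Rightarrow> 'e \<Rightarrow> 'v set" where
  "endpts G e = {v. (e, v) \<in> inc G}"

definition is_graph :: "('v, 'e) inc_graph \<Rightarrow> bool" where
  "is_graph G \<longleftrightarrow>
     finite (verts G) \<and> finite (edges G) \<and> inc G \<subseteq> edges G \<times> verts G \<and>
     (\<forall>e\<in>edges G. card (endpts G e) = 0 \<or> card (endpts G e) = 2)"

definition subgraph :: "('v, 'e) inc_graph \<Rightarrow> ('v, 'e) inc_graph \<Rightarrow> bool" where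
  "subgraph H G \<longleftrightarrow>
     verts H \<subseteq> verts G \<and> edges H \<subseteq> edges G \<and> inc H = inc G \<inter> (edges H \<times> verts H)"

datatype 'a trm = Sym0 'a | Sym1 'a "'a trm" | Sym2 'a "'a trm" "'a trm"

inductive_set Ter :: "'a set \<Rightarrow> 'a trm set" for \<Sigma> :: "'a set" where
  "a \<in> \<Sigma> \<Longrightarrow> Sym0 a \<in> Ter \<Sigma>"
| "a \<in> \<Sigma> \<Longrightarrow> t1 \<in> Ter \<Sigma> \<Longrightarrow> Sym1 a t1 \<in> Ter \<Sigma>"
| "a \<in> \<Sigma> \<Longrightarrow> t1 \<in> Ter \<Sigma> \<Longrightarrow> t2 \<in> Ter \<Sigma> \<Longrightarrow> Sym2 a t1 t2 \<in> Ter \<Sigma>"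

type_synonym pos = "nat list"

fun Pos :: "'a trm \<Rightarrow> pos set" where
  "Pos (Sym0 a) = {[]}"
| "Pos (Sym1 a t1) = {[]} \<union> {1 # p | p. p \<in> Pos t1}"
| "Pos (Sym2 a t1 t2) = {[]} \<union> {1 # p | p. p \<in> Pos t1} \<union> {2 # p | p. p \<in> Pos t2}"

text \<open>The symbol of a term at a position; only meaningful for positions of the term.\<close>

fun sym_at :: "'a trm \<Rightarrow> pos \<Rightarrow> 'a" where
  "sym_at (Sym0 a) [] = a"
| "sym_at (Sym1 a t1) [] = a"
| "sym_at (Sym2 a t1 t2) [] = a"
| "sym_at (Sym0 a) (j # p) = undefined"
| "sym_at (Sym1 a t1) (j # p) = (if j = 1 then sym_at t1 p else undefined)"
| "sym_at (Sym2 a t1 t2) (j # p) =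
     (if j = 1 then sym_at t1 p else if j = 2 then sym_at t2 p else undefined)"

definition arcs :: "(pos \<times> pos) set" where
  "arcs = {(p, q). \<exists>j. q = p @ [j] \<or> p = q @ [j]}"

definition connected_pos :: "'a trm \<Rightarrow> pos set \<Rightarrow> bool" where
  "connected_pos T P \<longleftrightarrow>
     P \<subseteq> Pos T \<and> (\<forall>p\<in>P. \<forall>q\<in>P. (p, q) \<in> (arcs \<inter> P \<times> P)\<^sup>*)"

type_synonym bag = "nat set \<times> nat set"

definition bags :: "nat \<Rightarrow> bag set" where
  "bags t = {(B, b). B \<subseteq> {1..t} \<and> b \<subseteq> B \<and> (b = {} \<or> card b = 2)}"

definition bag_B :: "bag trm \<Rightarrow> pos \<Rightarrow> nat set" where
  "bag_B T p = fst (sym_at T p)"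

definition bag_b :: "bag trm \<Rightarrow> pos \<Rightarrow> nat set" where
  "bag_b T p = snd (sym_at T p)"

definition s_maximal :: "bag trm \<Rightarrow> nat \<Rightarrow> pos set \<Rightarrow> bool" where
  "s_maximal T s P \<longleftrightarrow>
     P \<noteq> {} \<and> connected_pos T P \<and> (\<forall>p\<in>P. s \<in> bag_B T p) \<and>
     (\<forall>P'. connected_pos T P' \<and> (\<forall>p\<in>P'. s \<in> bag_B T p) \<longrightarrow> P \<inter> P' = {} \<or> P' \<subseteq> P)"

definition max_set :: "bag trm \<Rightarrow> pos \<Rightarrow> nat \<Rightarrow> pos set" where
  "max_set T p s = (THE P. s_maximal T s P \<and> p \<in> P)"

datatype vertex = Vtx nat "pos set"
datatype edge = Edg pos

definition graph_of :: "nat \<Rightarrow> bag trm \<Rightarrow> (vertex, edge) inc_graph" where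
  "graph_of t T =
     \<lparr>verts = {Vtx s P | s P. s \<in> {1..t} \<and> s_maximal T s P},
      edges = {Edg p | p. p \<in> Pos T \<and> bag_b T p \<noteq> {}},
      inc = {(Edg p, Vtx s (max_set T p s)) | p s.
               p \<in> Pos T \<and> bag_b T p \<noteq> {} \<and> s \<in> bag_b T p}\<rparr>"

definition sub_bag :: "bag \<Rightarrow> bag \<Rightarrow> bool" where
  "sub_bag x y \<longleftrightarrow> fst x \<subseteq> fst y \<and> snd x \<subseteq> snd y"

definition sub_decomposition :: "nat \<Rightarrow> bag trm \<Rightarrow> bag trm \<Rightarrow> bool" where
  "sub_decomposition t T T' \<longleftrightarrow>
     Pos T = Pos T' \<and>
     (\<forall>p\<in>Pos T. sub_bag (sym_at T p) (sym_at T' p)) \<and>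
     (\<forall>p j s. p \<in> Pos T' \<and> p @ [j] \<in> Pos T' \<and> s \<in> {1..t} \<and>
        s \<in> bag_B T' p \<and> s \<in> bag_B T' (p @ [j]) \<longrightarrow>
        (s \<notin> bag_B T p \<longleftrightarrow> s \<notin> bag_B T (p @ [j])))"

end

theory Submission
  imports Defs
begin

text \<open>
  The \<open>s\<close>-maximal sets are the connected components of the set of positions whose bag contains \<open>s\<close>.
  Condition (S3) says that for each \<open>s\<close> this set for \<open>T\<close> is a union of components of the one
  for \<open>T'\<close>; hence passing to a sub-decomposition amounts to selecting vertices of the graph, and
  (as nonempty \<open>b\<close>-parts have exactly two elements) edges whose endpoints are all selected.
  Conversely, a selection is realised by deleting the labels of unselected vertices and edges from
  the bags of \<open>T'\<close>. The edges of a subgraph need nonempty endpoint sets because an edge that loses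
  both its endpoints in \<open>G\<close> remains admissible for \<^const>\<open>is_graph\<close> but is not the edge of any bag.
\<close>

lemma subgraphI:
  assumes "verts H \<subseteq> verts G" and "edges H \<subseteq> edges G" and "inc H \<subseteq> edges H \<times> verts H"
    and "\<And>e. e \<in> edges H \<Longrightarrow> endpts H e = endpts G e"
  shows "subgraph H G"
  using assms by (fastforce simp: subgraph_def endpts_def)

lemma subgraph_eqI:
  assumes "subgraph H K" and "subgraph G K" and "verts H = verts G" and "edges H = edges G"
  shows "H = G"
  using assms by (simp add: subgraph_def)

lemma endpts_subset_verts: "is_graph G \<Longrightarrow> endpts G e \<subseteq> verts G"
  by (auto simp: is_graph_def endpts_def)

lemma subgraph_endpts_eq:
  assumes "is_graph H" and "is_graph G" and "subgraph H G"
    and "e \<in> edges H" and "endpts H e \<noteq> {}"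
  shows "endpts H e = endpts G e"
proof (rule card_subset_eq)
  show finite_endpts: "finite (endpts G e)"
    using endpts_subset_verts[OF \<open>is_graph G\<close>] \<open>is_graph G\<close>
    by (auto simp: is_graph_def intro: finite_subset)
  show sub: "endpts H e \<subseteq> endpts G e"
    using \<open>subgraph H G\<close> by (auto simp: subgraph_def endpts_def)
  have "e \<in> edges G" using assms(3,4) by (auto simp: subgraph_def)
  moreover have "card (endpts H e) \<noteq> 0" and "card (endpts G e) \<noteq> 0"
    using finite_endpts sub \<open>endpts H e \<noteq> {}\<close> by (auto simp: finite_subset)
  ultimately show "card (endpts H e) = card (endpts G e)"
    using assms(1,2,4) by (metis is_graph_def)
qed

definition component :: "'a rel \<Rightarrow> 'a set \<Rightarrow> 'a \<Rightarrow> 'a set" where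
  "component r A x = (r \<inter> A \<times> A)\<^sup>* `` {x}"

lemma self_in_component [simp]: "x \<in> component r A x"
  by (simp add: component_def)

lemma component_subset: "x \<in> A \<Longrightarrow> component r A x \<subseteq> A"
  by (auto simp: component_def elim: rtranclE)

lemma component_mono: "A \<subseteq> B \<Longrightarrow> component r A x \<subseteq> component r B x"
  unfolding component_def by (intro Image_mono rtrancl_mono) auto

lemma component_step:
  "y \<in> component r A x \<Longrightarrow> (y, z) \<in> r \<Longrightarrow> y \<in> A \<Longrightarrow> z \<in> A \<Longrightarrow> z \<in> component r A x"
  by (auto simp: component_def intro: rtrancl_into_rtrancl)

lemma component_eq:
  assumes "sym r" and "y \<in> component r A x"
  shows "component r A y = component r A x"
proof -
  have "sym ((r \<inter> A \<times> A)\<^sup>*)"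
    using \<open>sym r\<close> by (intro sym_rtrancl) (auto simp: sym_def)
  then show ?thesis
    using assms(2) by (auto simp: component_def dest: symD intro: rtrancl_trans)
qed

lemma component_of_closed_subset:
  assumes "A \<subseteq> B" and closed: "r `` A \<inter> B \<subseteq> A" and "x \<in> A"
  shows "component r A x = component r B x"
proof
  show "component r A x \<subseteq> component r B x" by (rule component_mono) fact
  show "component r B x \<subseteq> component r A x"
  proof
    fix y assume "y \<in> component r B x"
    then have "(x, y) \<in> (r \<inter> B \<times> B)\<^sup>*" by (simp add: component_def)
    then show "y \<in> component r A x"
    proof (induction rule: rtrancl_induct)
      case (step y z)
      have "y \<in> A" using step.IH component_subset[OF \<open>x \<in> A\<close>] by blast
      moreover from this have "z \<in> A" using step.hyps(2) closed by blast
      ultimately show ?case using step by (blast intro: component_step)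
    qed simp
  qed
qed

lemma component_component:
  assumes "sym r" and "x \<in> A" and "y \<in> component r A x"
  shows "component r (component r A x) y = component r A x"
proof -
  have "component r (component r A x) y = component r A y"
  proof (rule component_of_closed_subset)
    show "component r A x \<subseteq> A" by (rule component_subset) fact
    then show "r `` component r A x \<inter> A \<subseteq> component r A x"
      by (blast intro: component_step)
  qed fact
  also have "\<dots> = component r A x" by (rule component_eq) fact+
  finally show ?thesis .
qed

lemma sym_arcs: "sym arcs"
  by (auto simp: sym_def arcs_def)

lemma connected_pos_iff_component:
  "connected_pos T P \<longleftrightarrow> P \<subseteq> Pos T \<and> (\<forall>p\<in>P. P \<subseteq> component arcs P p)"
  by (auto simp: connected_pos_def component_def)

definition occurrences :: "bag trm \<Rightarrow> nat \<Rightarrow> pos set" where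
  "occurrences T s = {p \<in> Pos T. s \<in> bag_B T p}"

lemma s_maximal_iff_maximal_connected:
  "s_maximal T s P \<longleftrightarrow>
     P \<noteq> {} \<and> connected_pos T P \<and> P \<subseteq> occurrences T s \<and>
     (\<forall>Q. connected_pos T Q \<and> Q \<subseteq> occurrences T s \<longrightarrow> P \<inter> Q = {} \<or> Q \<subseteq> P)"
proof -
  have "(\<forall>p\<in>Q. s \<in> bag_B T p) \<longleftrightarrow> Q \<subseteq> occurrences T s" if "connected_pos T Q" for Q
    using that by (auto simp: connected_pos_def occurrences_def)
  then show ?thesis unfolding s_maximal_def by blast
qed

lemma connected_pos_subset_component:
  assumes "connected_pos T P" and "P \<subseteq> A" and "p \<in> P"
  shows "P \<subseteq> component arcs A p"
proof -
  have "P \<subseteq> component arcs P p"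
    using assms(1,3) by (simp add: connected_pos_iff_component)
  also have "\<dots> \<subseteq> component arcs A p" using \<open>P \<subseteq> A\<close> by (rule component_mono)
  finally show ?thesis .
qed

lemma s_maximal_component:
  assumes p: "p \<in> occurrences T s"
  shows "s_maximal T s (component arcs (occurrences T s) p)" (is "s_maximal T s ?C")
  unfolding s_maximal_iff_maximal_connected
proof (intro conjI allI impI)
  have "p \<in> ?C" by simp
  then show "?C \<noteq> {}" by blast
  show sub: "?C \<subseteq> occurrences T s" using p by (rule component_subset)
  then show "connected_pos T ?C"
    using component_component[OF sym_arcs p]
    by (auto simp: connected_pos_iff_component occurrences_def)
  fix Q assume "connected_pos T Q \<and> Q \<subseteq> occurrences T s"
  then have Q: "connected_pos T Q" "Q \<subseteq> occurrences T s" by simp_all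
  have "Q \<subseteq> ?C" if q: "q \<in> ?C" "q \<in> Q" for q
  proof -
    have "Q \<subseteq> component arcs (occurrences T s) q"
      using Q q(2) by (rule connected_pos_subset_component)
    then show ?thesis using component_eq[OF sym_arcs q(1)] by simp
  qed
  then show "?C \<inter> Q = {} \<or> Q \<subseteq> ?C" by blast
qed

lemma s_maximal_eq_component:
  assumes "s_maximal T s P" and "p \<in> P"
  shows "P = component arcs (occurrences T s) p" (is "P = ?C")
proof
  have P: "connected_pos T P" "P \<subseteq> occurrences T s"
    using assms(1) by (auto simp: s_maximal_iff_maximal_connected)
  then show "P \<subseteq> ?C" using \<open>p \<in> P\<close> by (rule connected_pos_subset_component)
  have "s_maximal T s ?C" using P \<open>p \<in> P\<close> by (blast intro: s_maximal_component)
  then show "?C \<subseteq> P"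
    using assms self_in_component[of p arcs "occurrences T s"]
    unfolding s_maximal_iff_maximal_connected by blast
qed

lemma max_set_eq_component:
  assumes "p \<in> occurrences T s"
  shows "max_set T p s = component arcs (occurrences T s) p"
  unfolding max_set_def
proof (rule the_equality)
  show "s_maximal T s (component arcs (occurrences T s) p) \<and>
      p \<in> component arcs (occurrences T s) p"
    using s_maximal_component[OF assms] by simp
next
  fix P assume "s_maximal T s P \<and> p \<in> P"
  then show "P = component arcs (occurrences T s) p"
    by (elim conjE) (rule s_maximal_eq_component)
qed

lemma s_maximal_iff_max_set: "s_maximal T s P \<longleftrightarrow> (\<exists>p\<in>occurrences T s. P = max_set T p s)"
proof
  assume P: "s_maximal T s P"
  then obtain p where "p \<in> P" "p \<in> occurrences T s"
    by (auto simp: s_maximal_iff_maximal_connected)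
  with P show "\<exists>p\<in>occurrences T s. P = max_set T p s"
    using s_maximal_eq_component max_set_eq_component by blast
qed (auto simp: max_set_eq_component s_maximal_component)

lemma max_set_eq_of_arc:
  assumes "p \<in> occurrences T s" and "q \<in> occurrences T s" and "(p, q) \<in> arcs"
  shows "max_set T p s = max_set T q s"
proof -
  have "q \<in> component arcs (occurrences T s) p"
    using assms by (intro component_step[OF self_in_component])
  then show ?thesis using assms component_eq[OF sym_arcs] by (simp add: max_set_eq_component)
qed

definition vertex_at :: "bag trm \<Rightarrow> pos \<Rightarrow> nat \<Rightarrow> vertex" where
  "vertex_at T p s = Vtx s (max_set T p s)"

lemma verts_graph_of:
  "verts (graph_of t T) = {vertex_at T p s | p s. s \<in> {1..t} \<and> p \<in> occurrences T s}"
  by (auto simp: graph_of_def s_maximal_iff_max_set vertex_at_def)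

lemma edges_graph_of: "edges (graph_of t T) = {Edg p | p. p \<in> Pos T \<and> bag_b T p \<noteq> {}}"
  by (simp add: graph_of_def)

lemma inc_graph_of:
  "inc (graph_of t T) = {(Edg p, vertex_at T p s) | p s. p \<in> Pos T \<and> s \<in> bag_b T p}"
  by (auto simp: graph_of_def vertex_at_def)

lemma endpts_graph_of: "p \<in> Pos T \<Longrightarrow> endpts (graph_of t T) (Edg p) = vertex_at T p ` bag_b T p"
  by (auto simp: endpts_def inc_graph_of)

lemma endpts_graph_of_nonempty: "e \<in> edges (graph_of t T) \<Longrightarrow> endpts (graph_of t T) e \<noteq> {}"
  by (auto simp: edges_graph_of endpts_graph_of)

lemma Ter_iff_sym_at: "T \<in> Ter \<Sigma> \<longleftrightarrow> (\<forall>p\<in>Pos T. sym_at T p \<in> \<Sigma>)"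
proof
  assume "T \<in> Ter \<Sigma>"
  then show "\<forall>p\<in>Pos T. sym_at T p \<in> \<Sigma>"
    by (induction rule: Ter.induct) auto
next
  assume "\<forall>p\<in>Pos T. sym_at T p \<in> \<Sigma>"
  then show "T \<in> Ter \<Sigma>"
    by (induction T) (auto simp: ball_Un setcompr_eq_image intro!: Ter.intros)
qed

lemma Ter_bags_iff:
  "T \<in> Ter (bags t) \<longleftrightarrow>
     (\<forall>p\<in>Pos T. bag_B T p \<subseteq> {1..t} \<and> bag_b T p \<subseteq> bag_B T p \<and>
        (bag_b T p = {} \<or> card (bag_b T p) = 2))"
  by (simp add: Ter_iff_sym_at bags_def bag_B_def bag_b_def case_prod_beta)

lemma bag_b_occurrence:
  assumes "T \<in> Ter (bags t)" and "p \<in> Pos T" and "s \<in> bag_b T p"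
  shows "s \<in> {1..t}" and "p \<in> occurrences T s"
proof -
  have "bag_B T p \<subseteq> {1..t}" "bag_b T p \<subseteq> bag_B T p"
    using assms(1,2) by (simp_all add: Ter_bags_iff)
  with assms(2,3) show "s \<in> {1..t}" and "p \<in> occurrences T s"
    by (auto simp: occurrences_def)
qed

lemma inc_graph_of_subset:
  assumes "T \<in> Ter (bags t)"
  shows "inc (graph_of t T) \<subseteq> edges (graph_of t T) \<times> verts (graph_of t T)"
  unfolding inc_graph_of edges_graph_of verts_graph_of
  using bag_b_occurrence[OF assms] by blast

lemma sub_decomposition_iff:
  "sub_decomposition t T T' \<longleftrightarrow>
     Pos T = Pos T' \<and>
     (\<forall>p\<in>Pos T. bag_B T p \<subseteq> bag_B T' p \<and> bag_b T p \<subseteq> bag_b T' p) \<and>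
     (\<forall>s\<in>{1..t}. \<forall>p\<in>occurrences T' s. \<forall>q\<in>occurrences T' s.
        (p, q) \<in> arcs \<longrightarrow> p \<in> occurrences T s \<longrightarrow> q \<in> occurrences T s)"
  (is "_ \<longleftrightarrow> ?pos \<and> ?bags \<and> ?closed")
proof (cases ?pos)
  case True
  then have "?closed \<longleftrightarrow> (\<forall>p j s. p \<in> Pos T' \<and> p @ [j] \<in> Pos T' \<and> s \<in> {1..t} \<and>
      s \<in> bag_B T' p \<and> s \<in> bag_B T' (p @ [j]) \<longrightarrow>
      (s \<notin> bag_B T p \<longleftrightarrow> s \<notin> bag_B T (p @ [j])))"
    unfolding arcs_def occurrences_def by blast
  then show ?thesis
    unfolding sub_decomposition_def sub_bag_def bag_B_def bag_b_def by blast
qed (simp add: sub_decomposition_def)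

lemma sub_decomposition_occurrences_subset:
  "sub_decomposition t T T' \<Longrightarrow> occurrences T s \<subseteq> occurrences T' s"
  by (auto simp: sub_decomposition_iff occurrences_def)

lemma sub_decomposition_vertex_at:
  assumes sub: "sub_decomposition t T T'" and "s \<in> {1..t}" and p: "p \<in> occurrences T s"
  shows "vertex_at T p s = vertex_at T' p s"
proof -
  have mono: "occurrences T s \<subseteq> occurrences T' s"
    using sub by (rule sub_decomposition_occurrences_subset)
  moreover have "arcs `` occurrences T s \<inter> occurrences T' s \<subseteq> occurrences T s"
    using sub mono \<open>s \<in> {1..t}\<close> unfolding sub_decomposition_iff by blast
  ultimately have "component arcs (occurrences T s) p = component arcs (occurrences T' s) p"
    using p by (rule component_of_closed_subset)
  then show ?thesis
    using p mono by (auto simp: vertex_at_def max_set_eq_component)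
qed

lemma sub_decomposition_bag_b:
  assumes sub: "sub_decomposition t T T'" and "T \<in> Ter (bags t)" and "T' \<in> Ter (bags t)"
    and p: "p \<in> Pos T" and "bag_b T p \<noteq> {}"
  shows "bag_b T p = bag_b T' p"
proof (rule card_subset_eq)
  have p': "p \<in> Pos T'" and subset: "bag_b T p \<subseteq> bag_b T' p"
    using sub p by (simp_all add: sub_decomposition_iff)
  show "bag_b T p \<subseteq> bag_b T' p" by fact
  have "bag_b T' p \<noteq> {}" using subset \<open>bag_b T p \<noteq> {}\<close> by blast
  then have "card (bag_b T p) = 2" "card (bag_b T' p) = 2"
    using assms(2,3,5) p p' unfolding Ter_bags_iff by blast+
  then show "card (bag_b T p) = card (bag_b T' p)" "finite (bag_b T' p)"
    by (auto intro: card_ge_0_finite)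
qed

lemma sub_decomposition_subgraph:
  assumes sub: "sub_decomposition t T T'" and T: "T \<in> Ter (bags t)" and T': "T' \<in> Ter (bags t)"
  shows "subgraph (graph_of t T) (graph_of t T')"
proof (rule subgraphI)
  have pos: "Pos T = Pos T'" using sub by (simp add: sub_decomposition_iff)
  note bag_b_eq = sub_decomposition_bag_b[OF sub T T']
  note vertex_eq = sub_decomposition_vertex_at[OF sub]
  show "verts (graph_of t T) \<subseteq> verts (graph_of t T')"
    unfolding verts_graph_of
    using vertex_eq sub_decomposition_occurrences_subset[OF sub] by blast
  show "edges (graph_of t T) \<subseteq> edges (graph_of t T')"
    using bag_b_eq pos by (fastforce simp: edges_graph_of)
  show "inc (graph_of t T) \<subseteq> edges (graph_of t T) \<times> verts (graph_of t T)"
    using T by (rule inc_graph_of_subset)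
  fix e assume "e \<in> edges (graph_of t T)"
  then obtain p where e: "e = Edg p" and p: "p \<in> Pos T" "bag_b T p \<noteq> {}"
    by (auto simp: edges_graph_of)
  have "vertex_at T p s = vertex_at T' p s" if "s \<in> bag_b T p" for s
    using bag_b_occurrence[OF T p(1) that] by (rule vertex_eq)
  then show "endpts (graph_of t T) e = endpts (graph_of t T') e"
    using bag_b_eq[OF p] p(1) pos by (auto simp: e endpts_graph_of)
qed

fun relabel :: "(pos \<Rightarrow> 'b) \<Rightarrow> 'a trm \<Rightarrow> 'b trm" where
  "relabel f (Sym0 a) = Sym0 (f [])"
| "relabel f (Sym1 a t1) = Sym1 (f []) (relabel (\<lambda>p. f (1 # p)) t1)"
| "relabel f (Sym2 a t1 t2) =
     Sym2 (f []) (relabel (\<lambda>p. f (1 # p)) t1) (relabel (\<lambda>p. f (2 # p)) t2)"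

lemma Pos_relabel [simp]: "Pos (relabel f T) = Pos T"
  by (induction T arbitrary: f) auto

lemma sym_at_relabel: "p \<in> Pos T \<Longrightarrow> sym_at (relabel f T) p = f p"
  by (induction T arbitrary: f p) auto

definition restrict_decomposition :: "bag trm \<Rightarrow> (vertex, edge) inc_graph \<Rightarrow> bag trm" where
  "restrict_decomposition T G =
     relabel (\<lambda>p. ({s \<in> bag_B T p. vertex_at T p s \<in> verts G},
                   if Edg p \<in> edges G then bag_b T p else {})) T"

lemma Pos_restrict_decomposition [simp]: "Pos (restrict_decomposition T G) = Pos T"
  by (simp add: restrict_decomposition_def)

lemma bag_B_restrict_decomposition:
  "p \<in> Pos T \<Longrightarrow>
     bag_B (restrict_decomposition T G) p = {s \<in> bag_B T p. vertex_at T p s \<in> verts G}"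
  by (simp add: restrict_decomposition_def bag_B_def sym_at_relabel)

lemma bag_b_restrict_decomposition:
  "p \<in> Pos T \<Longrightarrow>
     bag_b (restrict_decomposition T G) p = (if Edg p \<in> edges G then bag_b T p else {})"
  by (simp add: restrict_decomposition_def bag_b_def sym_at_relabel)

lemma occurrences_restrict_decomposition:
  "occurrences (restrict_decomposition T G) s =
     {p \<in> occurrences T s. vertex_at T p s \<in> verts G}"
  by (auto simp: occurrences_def bag_B_restrict_decomposition)

lemma restrict_decomposition_in_Ter_bags:
  assumes "T \<in> Ter (bags t)" and closed: "\<forall>e\<in>edges G. endpts (graph_of t T) e \<subseteq> verts G"
  shows "restrict_decomposition T G \<in> Ter (bags t)"
proof -
  have "vertex_at T p s \<in> verts G" if "p \<in> Pos T" "Edg p \<in> edges G" "s \<in> bag_b T p" for p s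
    using closed that endpts_graph_of[of p T t] by blast
  then show ?thesis
    using assms(1)
    by (auto simp: Ter_bags_iff bag_B_restrict_decomposition bag_b_restrict_decomposition)
qed

lemma sub_decomposition_restrict_decomposition:
  "sub_decomposition t (restrict_decomposition T G) T"
proof -
  have "vertex_at T p s = vertex_at T q s"
    if "p \<in> occurrences T s" "q \<in> occurrences T s" "(p, q) \<in> arcs" for p q s
    using max_set_eq_of_arc[OF that] by (simp add: vertex_at_def)
  then show ?thesis
    by (auto simp: sub_decomposition_iff bag_B_restrict_decomposition
        bag_b_restrict_decomposition occurrences_restrict_decomposition split: if_splits)
qed

lemma verts_graph_of_restrict_decomposition:
  "verts (graph_of t (restrict_decomposition T G)) = verts (graph_of t T) \<inter> verts G"
proof -
  have "verts (graph_of t (restrict_decomposition T G)) =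
      {vertex_at T p s | p s. s \<in> {1..t} \<and> p \<in> occurrences (restrict_decomposition T G) s}"
    unfolding verts_graph_of
    using sub_decomposition_vertex_at[OF sub_decomposition_restrict_decomposition] by metis
  then show ?thesis
    by (auto simp: verts_graph_of occurrences_restrict_decomposition)
qed

lemma edges_graph_of_restrict_decomposition:
  "edges (graph_of t (restrict_decomposition T G)) = edges (graph_of t T) \<inter> edges G"
  by (auto simp: edges_graph_of bag_b_restrict_decomposition split: if_splits)

lemma graph_of_restrict_decomposition:
  assumes T: "T \<in> Ter (bags t)" and sub: "subgraph G (graph_of t T)"
    and closed: "\<forall>e\<in>edges G. endpts (graph_of t T) e \<subseteq> verts G"
  shows "graph_of t (restrict_decomposition T G) = G"
proof (rule subgraph_eqI)
  show "subgraph (graph_of t (restrict_decomposition T G)) (graph_of t T)"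
    using sub_decomposition_restrict_decomposition
      restrict_decomposition_in_Ter_bags[OF T closed] T
    by (rule sub_decomposition_subgraph)
  show "verts (graph_of t (restrict_decomposition T G)) = verts G"
    and "edges (graph_of t (restrict_decomposition T G)) = edges G"
    using sub by (auto simp: subgraph_def verts_graph_of_restrict_decomposition
        edges_graph_of_restrict_decomposition)
qed fact

theorem theorem4p2:
  fixes G G' :: "(vertex, edge) inc_graph" and t :: nat and T' :: "bag trm"
  assumes "is_graph G" and "is_graph G'"
    and "T' \<in> Ter (bags t)" and "graph_of t T' = G'"
  shows "subgraph G G' \<and> (\<forall>e\<in>edges G. endpts G e \<noteq> {}) \<longleftrightarrow>
    (\<exists>T \<in> Ter (bags t). sub_decomposition t T T' \<and> graph_of t T = G)"
proof
  assume sub: "subgraph G G' \<and> (\<forall>e\<in>edges G. endpts G e \<noteq> {})"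
  then have "\<forall>e\<in>edges G. endpts G' e \<subseteq> verts G"
    using subgraph_endpts_eq[OF assms(1,2)] endpts_subset_verts[OF assms(1)] by blast
  then have "restrict_decomposition T' G \<in> Ter (bags t)"
    and "graph_of t (restrict_decomposition T' G) = G"
    using assms(3,4) sub restrict_decomposition_in_Ter_bags graph_of_restrict_decomposition
    by blast+
  then show "\<exists>T \<in> Ter (bags t). sub_decomposition t T T' \<and> graph_of t T = G"
    using sub_decomposition_restrict_decomposition by blast
next
  assume "\<exists>T \<in> Ter (bags t). sub_decomposition t T T' \<and> graph_of t T = G"
  then show "subgraph G G' \<and> (\<forall>e\<in>edges G. endpts G e \<noteq> {})"
    using sub_decomposition_subgraph endpts_graph_of_nonempty assms(3,4) by blast
qed

end
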